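(* There exists a finite filtration $$K_\bullet=\{K_0\subset K_1\subset K_2\}$$ of connected finite simplicial complexes such that: (i) for all $i\le j$ in $\{0,1,2\}$ the map $H_*(K_i)\to H_*(K_j)$ induced by the inclusion is an isomorphism; (ii) the persistence module $H_*(K_\bullet)$ is isomorphic to that of a point; (iii) the Morse complexity profile $\mathcal{M}(K_\bullet)=\{M(K_t)\}_{t\in\{0,1,2\}}$ is non-constant.
   Context: A filtration is an increasing chain of simplicial complexes, each a subcomplex of the next. Homology is with integer coefficients. The persistence module $H_*(K_\bullet)$ is the sequence $H_*(K_0)\to H_*(K_1)\to H_*(K_2)$ with maps induced by inclusions; "that of a point" means the persistence module of the constant filtration by a one-point complex. A discrete Morse function on a finite simplicial complex $K$ is a function $f$ from the set of simplices of $K$ to $\mathbb{R}$ such that for every simplex $\sigma^r$ (of dimension $r$) the set $\widetilde{M}(\sigma)=\{\tau^{r-1}\subset\sigma^r : f(\tau)\ge f(\sigma)\}\cup\{\tau^{r+1}\supset\sigma^r : f(\tau)\le f(\sigma)\}$ contains at most one element. A simplex $\sigma$ is critical for $f$ if $\widetilde{M}(\sigma)=\varnothing$. Let $c_i(f)$ be the number of critical $i$-simplices of $f$. The minimal Morse number is $M(K)=\min_f \sum_{i\ge 0} c_i(f)$, the minimum being over all discrete Morse functions $f$ on $K$. *)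

theory Defs
  imports "HOL-Algebra.Free_Abelian_Groups" Complex_Main
begin

section \<open>Finite simplicial complexes\<close>

text \<open>Abstract complexes; a simplex is its nonempty vertex set, and the empty simplex is excluded.\<close>

definition finite_complex :: "'a set set \<Rightarrow> bool" where
  "finite_complex K \<longleftrightarrow>
     finite K \<and> (\<forall>\<sigma>\<in>K. finite \<sigma> \<and> \<sigma> \<noteq> {}) \<and>
     (\<forall>\<sigma>\<in>K. \<forall>\<tau>. \<tau> \<subseteq> \<sigma> \<longrightarrow> \<tau> \<noteq> {} \<longrightarrow> \<tau> \<in> K)"

definition sdim :: "'a set \<Rightarrow> nat" where
  "sdim \<sigma> = card \<sigma> - 1"

definition simplices :: "nat \<Rightarrow> 'a set set \<Rightarrow> 'a set set" where
  "simplices p K = {\<sigma> \<in> K. sdim \<sigma> = p}"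

text \<open>Connectedness by edge paths (degenerate edges \<open>{a, a}\<close> are harmless);
  the empty complex does not count as connected.\<close>

definition connected_complex :: "'a set set \<Rightarrow> bool" where
  "connected_complex K \<longleftrightarrow>
     K \<noteq> {} \<and> (\<forall>u\<in>\<Union>K. \<forall>v\<in>\<Union>K. (u, v) \<in> {(a, b). {a, b} \<in> K}\<^sup>*)"

definition filtration :: "nat \<Rightarrow> (nat \<Rightarrow> 'a set set) \<Rightarrow> bool" where
  "filtration n K \<longleftrightarrow> (\<forall>t\<le>n. finite_complex (K t)) \<and> (\<forall>t<n. K t \<subseteq> K (Suc t))"


section \<open>Simplicial homology with integer coefficients\<close>

text \<open>Simplices are oriented by the order on the vertices.  If \<open>\<sigma>\<close> has vertices
  \<open>v\<^sub>0 < \<dots> < v\<^sub>p\<close>, then \<open>card {w \<in> \<sigma>. w < v}\<close> is the index of the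
  vertex \<open>v\<close>, so this is the alternating sum of the facets of \<open>\<sigma>\<close>.\<close>

definition simplex_boundary :: "'a::linorder set \<Rightarrow> ('a set \<Rightarrow>\<^sub>0 int)" where
  "simplex_boundary \<sigma> =
     (\<Sum>v\<in>\<sigma>. frag_cmul ((-1) ^ card {w \<in> \<sigma>. w < v}) (frag_of (\<sigma> - {v})))"

text \<open>In degree \<open>0\<close> the formula above would give the augmentation (with values in the span
  of the empty simplex), so the boundary is set to \<open>0\<close> there: the homology is unreduced.\<close>

definition chain_bd :: "nat \<Rightarrow> ('a::linorder set \<Rightarrow>\<^sub>0 int) \<Rightarrow> ('a set \<Rightarrow>\<^sub>0 int)" where
  "chain_bd p c = (if p = 0 then 0 else frag_extend simplex_boundary c)"

definition simplicial_chain_group :: "nat \<Rightarrow> 'a set set \<Rightarrow> ('a set \<Rightarrow>\<^sub>0 int) monoid" where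
  "simplicial_chain_group p K = free_Abelian_group (simplices p K)"

definition simplicial_cycles :: "nat \<Rightarrow> 'a::linorder set set \<Rightarrow> ('a set \<Rightarrow>\<^sub>0 int) set" where
  "simplicial_cycles p K = {c \<in> carrier (simplicial_chain_group p K). chain_bd p c = 0}"

definition simplicial_boundaries :: "nat \<Rightarrow> 'a::linorder set set \<Rightarrow> ('a set \<Rightarrow>\<^sub>0 int) set" where
  "simplicial_boundaries p K = chain_bd (Suc p) ` carrier (simplicial_chain_group (Suc p) K)"

definition simplicial_cycle_group :: "nat \<Rightarrow> 'a::linorder set set \<Rightarrow> ('a set \<Rightarrow>\<^sub>0 int) monoid" where
  "simplicial_cycle_group p K =
     subgroup_generated (simplicial_chain_group p K) (simplicial_cycles p K)"

definition simplicial_homology ::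
    "nat \<Rightarrow> 'a::linorder set set \<Rightarrow> ('a set \<Rightarrow>\<^sub>0 int) set monoid" where
  "simplicial_homology p K = simplicial_cycle_group p K Mod simplicial_boundaries p K"

text \<open>The map induced by an inclusion \<open>K \<subseteq> L\<close>.  A homology class \<open>X\<close> of \<open>K\<close> is a coset, and for
  all \<open>c \<in> X\<close> the coset of \<open>c\<close> modulo boundaries of \<open>L\<close> is the same
  (see \<open>homology_incl_coset\<close> below), so the union is that one coset.\<close>

definition homology_incl ::
    "nat \<Rightarrow> 'a::linorder set set \<Rightarrow> 'a set set \<Rightarrow> ('a set \<Rightarrow>\<^sub>0 int) set \<Rightarrow> ('a set \<Rightarrow>\<^sub>0 int) set" where
  "homology_incl p K L X =
     (\<Union>c\<in>X. simplicial_boundaries p L #>\<^bsub>simplicial_cycle_group p L\<^esub> c)"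


section \<open>Persistence modules\<close>

text \<open>A persistence module \<open>G 0 \<rightarrow> \<dots> \<rightarrow> G n\<close> of abelian groups is given by the groups \<open>G\<close>
  and the structure maps \<open>g t : G t \<rightarrow> G (Suc t)\<close>.  An isomorphism is a levelwise isomorphism
  of groups that commutes with the structure maps.\<close>

definition persistence_iso ::
    "nat \<Rightarrow> (nat \<Rightarrow> 'a monoid) \<Rightarrow> (nat \<Rightarrow> 'a \<Rightarrow> 'a)
       \<Rightarrow> (nat \<Rightarrow> 'b monoid) \<Rightarrow> (nat \<Rightarrow> 'b \<Rightarrow> 'b) \<Rightarrow> bool" where
  "persistence_iso n G g H h \<longleftrightarrow>
     (\<exists>\<eta>. (\<forall>t\<le>n. \<eta> t \<in> iso (G t) (H t)) \<and>
          (\<forall>t<n. \<forall>x\<in>carrier (G t). \<eta> (Suc t) (g t x) = h t (\<eta> t x)))"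

text \<open>Isomorphism of the graded modules \<open>H\<^sub>*(K\<^sub>\<bullet>)\<close> and \<open>H\<^sub>*(L\<^sub>\<bullet>)\<close>, i.e. degree by degree.\<close>

definition homology_persistence_iso ::
    "nat \<Rightarrow> (nat \<Rightarrow> 'a::linorder set set) \<Rightarrow> (nat \<Rightarrow> 'b::linorder set set) \<Rightarrow> bool" where
  "homology_persistence_iso n K L \<longleftrightarrow>
     (\<forall>p. persistence_iso n
        (\<lambda>t. simplicial_homology p (K t)) (\<lambda>t. homology_incl p (K t) (K (Suc t)))
        (\<lambda>t. simplicial_homology p (L t)) (\<lambda>t. homology_incl p (L t) (L (Suc t))))"


section \<open>Discrete Morse functions\<close>

text \<open>Only the values of \<open>f\<close> on the simplices of \<open>K\<close> matter.\<close>

definition morse_exceptions :: "'a set set \<Rightarrow> ('a set \<Rightarrow> real) \<Rightarrow> 'a set \<Rightarrow> 'a set set" where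
  "morse_exceptions K f \<sigma> =
     {\<tau> \<in> K. \<tau> \<subset> \<sigma> \<and> sdim \<sigma> = Suc (sdim \<tau>) \<and> f \<tau> \<ge> f \<sigma>} \<union>
     {\<tau> \<in> K. \<sigma> \<subset> \<tau> \<and> sdim \<tau> = Suc (sdim \<sigma>) \<and> f \<tau> \<le> f \<sigma>}"

definition discrete_morse :: "'a set set \<Rightarrow> ('a set \<Rightarrow> real) \<Rightarrow> bool" where
  "discrete_morse K f \<longleftrightarrow> (\<forall>\<sigma>\<in>K. \<exists>\<tau>. morse_exceptions K f \<sigma> \<subseteq> {\<tau>})"

definition critical :: "'a set set \<Rightarrow> ('a set \<Rightarrow> real) \<Rightarrow> 'a set \<Rightarrow> bool" where
  "critical K f \<sigma> \<longleftrightarrow> \<sigma> \<in> K \<and> morse_exceptions K f \<sigma> = {}"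

definition critical_count :: "'a set set \<Rightarrow> ('a set \<Rightarrow> real) \<Rightarrow> nat \<Rightarrow> nat" where
  "critical_count K f i = card {\<sigma> \<in> simplices i K. critical K f \<sigma>}"

text \<open>The number of critical \<open>i\<close>-simplices vanishes unless \<open>i\<close> is the dimension of a
  simplex of \<open>K\<close>.\<close>

definition morse_number :: "'a set set \<Rightarrow> nat" where
  "morse_number K =
     (LEAST m. \<exists>f. discrete_morse K f \<and> m = (\<Sum>i\<in>sdim ` K. critical_count K f i))"


section \<open>Well-definedness of homology and of the induced maps\<close>

lemma simplex_boundary_boundary:
  assumes "finite \<sigma>"
  shows "frag_extend simplex_boundary (simplex_boundary \<sigma>) = 0"
proof -
  define e where "e v S = ((-1)::int) ^ card {w \<in> S. w < v}" for v :: 'a and S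
  define T where "T v w = (if v = w then 0 else
      frag_cmul (e v \<sigma> * e w (\<sigma> - {v})) (frag_of (\<sigma> - {v} - {w})))" for v w
  have sb: "simplex_boundary S = (\<Sum>v\<in>S. frag_cmul (e v S) (frag_of (S - {v})))" for S
    by (simp add: simplex_boundary_def e_def)
  have e1: "e w (\<sigma> - {v}) = e w \<sigma>" if "w \<le> v" for v w
  proof -
    have "{x \<in> \<sigma> - {v}. x < w} = {x \<in> \<sigma>. x < w}" using that by auto
    then show ?thesis by (simp add: e_def)
  qed
  have e2: "e w (\<sigma> - {v}) = - e w \<sigma>" if "v < w" "v \<in> \<sigma>" for v w
  proof -
    have eq: "{x \<in> \<sigma>. x < w} = insert v {x \<in> \<sigma> - {v}. x < w}" using that by auto
    have "card {x \<in> \<sigma>. x < w} = Suc (card {x \<in> \<sigma> - {v}. x < w})"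
      unfolding eq using assms by (subst card_insert_disjoint) auto
    then show ?thesis by (simp add: e_def)
  qed
  have anti: "T v w = - T w v" if "v \<in> \<sigma>" "w \<in> \<sigma>" for v w
  proof -
    have d: "\<sigma> - {v} - {w} = \<sigma> - {v, w}" "\<sigma> - {w} - {v} = \<sigma> - {v, w}" by auto
    consider "v = w" | "v < w" | "w < v" by fastforce
    then show ?thesis
      by cases (use that in \<open>simp_all only: T_def d e1 e2 less_imp_le minus_frag_cmul, simp_all add: mult.commute\<close>)
  qed
  have "frag_extend simplex_boundary (simplex_boundary \<sigma>)
      = (\<Sum>v\<in>\<sigma>. frag_cmul (e v \<sigma>) (simplex_boundary (\<sigma> - {v})))"
    by (subst sb) (simp add: frag_extend_sum[OF assms] frag_extend_cmul o_def)
  also have "\<dots> = (\<Sum>v\<in>\<sigma>. \<Sum>w\<in>\<sigma>. T v w)"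
  proof (rule sum.cong[OF refl])
    fix v assume v: "v \<in> \<sigma>"
    have "frag_cmul (e v \<sigma>) (simplex_boundary (\<sigma> - {v})) = (\<Sum>w\<in>\<sigma> - {v}. T v w)"
      unfolding sb using assms by (simp add: frag_cmul_sum) (rule sum.cong, auto simp: T_def)
    also have "\<dots> = (\<Sum>w\<in>\<sigma>. T v w)"
      using assms by (intro sum.mono_neutral_left) (auto simp: T_def)
    finally show "frag_cmul (e v \<sigma>) (simplex_boundary (\<sigma> - {v})) = (\<Sum>w\<in>\<sigma>. T v w)" .
  qed
  finally have S: "frag_extend simplex_boundary (simplex_boundary \<sigma>) = (\<Sum>v\<in>\<sigma>. \<Sum>w\<in>\<sigma>. T v w)" .
  have "(\<Sum>v\<in>\<sigma>. \<Sum>w\<in>\<sigma>. T v w) = (\<Sum>v\<in>\<sigma>. \<Sum>w\<in>\<sigma>. - T w v)"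
    by (intro sum.cong refl anti)
  also have "\<dots> = - (\<Sum>v\<in>\<sigma>. \<Sum>w\<in>\<sigma>. T w v)" by (simp add: sum_negf)
  also have "(\<Sum>v\<in>\<sigma>. \<Sum>w\<in>\<sigma>. T w v) = (\<Sum>v\<in>\<sigma>. \<Sum>w\<in>\<sigma>. T v w)" by (rule sum.swap)
  finally have "(\<Sum>v\<in>\<sigma>. \<Sum>w\<in>\<sigma>. T v w) = - (\<Sum>v\<in>\<sigma>. \<Sum>w\<in>\<sigma>. T v w)" .
  then have "Poly_Mapping.lookup (\<Sum>v\<in>\<sigma>. \<Sum>w\<in>\<sigma>. T v w) k = - Poly_Mapping.lookup (\<Sum>v\<in>\<sigma>. \<Sum>w\<in>\<sigma>. T v w) k" for k
    by (metis lookup_uminus)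
  then have "(\<Sum>v\<in>\<sigma>. \<Sum>w\<in>\<sigma>. T v w) = 0"
    by (intro poly_mapping_eqI) (simp add: eq_neg_iff_add_eq_0)
  then show ?thesis using S by simp
qed

lemma chain_bd_diff: "chain_bd p (a - b) = chain_bd p a - chain_bd p b"
  by (simp add: chain_bd_def frag_extend_diff)

lemma chain_bd_add: "chain_bd p (a + b) = chain_bd p a + chain_bd p b"
  by (simp add: chain_bd_def frag_extend_add)

lemma chain_bd_minus: "chain_bd p (- a) = - chain_bd p a"
  by (simp add: chain_bd_def frag_extend_minus)

lemma chain_bd_0: "chain_bd p 0 = 0"
  by (simp add: chain_bd_def)

lemma chain_bd_chain_bd:
  assumes "finite_complex K" "c \<in> carrier (simplicial_chain_group (Suc p) K)"
  shows "chain_bd p (chain_bd (Suc p) c) = 0"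
proof -
  have "Poly_Mapping.keys c \<subseteq> simplices (Suc p) K"
    using assms(2) by (simp add: simplicial_chain_group_def)
  then have "chain_bd p (chain_bd (Suc p) c) = 0"
  proof (induction c rule: frag_induction)
    case (one \<sigma>)
    then have "finite \<sigma>" using assms(1) by (auto simp: finite_complex_def simplices_def)
    then have "frag_extend simplex_boundary (simplex_boundary \<sigma>) = 0"
      by (rule simplex_boundary_boundary)
    then show ?case by (simp add: chain_bd_def)
  qed (simp_all add: chain_bd_diff chain_bd_0)
  then show ?thesis .
qed

lemma chain_bd_closed:
  assumes "finite_complex K" "c \<in> carrier (simplicial_chain_group (Suc p) K)"
  shows "chain_bd (Suc p) c \<in> carrier (simplicial_chain_group p K)"
proof -
  have "Poly_Mapping.keys c \<subseteq> simplices (Suc p) K"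
    using assms(2) by (simp add: simplicial_chain_group_def)
  then show ?thesis
  proof (induction c rule: frag_induction)
    case zero
    then show ?case by (simp add: chain_bd_0 simplicial_chain_group_def)
  next
    case (one \<sigma>)
    then have s: "\<sigma> \<in> K" "card \<sigma> = Suc (Suc p)"
      unfolding simplices_def sdim_def by auto
    then have fin: "finite \<sigma>" using card_ge_0_finite by force
    have "\<sigma> - {v} \<in> simplices p K" if v: "v \<in> \<sigma>" for v
    proof -
      have c: "card (\<sigma> - {v}) = Suc p" using v s(2) fin by simp
      have "\<sigma> - {v} \<noteq> {}"
      proof
        assume "\<sigma> - {v} = {}"
        then show False using c by (simp only: card.empty)
      qed
      moreover have "\<forall>\<tau>. \<tau> \<subseteq> \<sigma> \<longrightarrow> \<tau> \<noteq> {} \<longrightarrow> \<tau> \<in> K"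
        using assms(1) s(1) unfolding finite_complex_def by (elim conjE) (erule (1) bspec)
      ultimately have "\<sigma> - {v} \<in> K" by (meson Diff_subset)
      then show ?thesis using c by (simp add: simplices_def sdim_def)
    qed
    then show ?case
      unfolding simplicial_chain_group_def chain_bd_def simplex_boundary_def
      by (simp only: nat.distinct if_False frag_extend_of simplex_boundary_def,
          intro sum_closed_free_Abelian_group)
         (simp add: order_trans[OF keys_cmul] keys_frag_of)
  next
    case (diff a b)
    then show ?case
      unfolding simplicial_chain_group_def chain_bd_diff carrier_free_Abelian_group_iff
      by (meson keys_diff le_sup_iff subset_trans)
  qed
qed

lemma subgroup_simplicial_cycles:
  "subgroup (simplicial_cycles p K) (simplicial_chain_group p K)"
proof -
  have G: "group (simplicial_chain_group p K)"
    by (simp add: simplicial_chain_group_def)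
  show ?thesis
  proof (rule group.subgroupI[OF G])
    show "simplicial_cycles p K \<noteq> {}"
      by (auto simp: simplicial_cycles_def simplicial_chain_group_def chain_bd_0 intro!: exI[of _ 0])
  next
    fix a b assume "a \<in> simplicial_cycles p K" "b \<in> simplicial_cycles p K"
    then show "a \<otimes>\<^bsub>simplicial_chain_group p K\<^esub> b \<in> simplicial_cycles p K"
      using keys_add[of a b]
      by (auto simp: simplicial_cycles_def simplicial_chain_group_def chain_bd_add)
  qed (auto simp: simplicial_cycles_def simplicial_chain_group_def chain_bd_minus)
qed

lemma carrier_simplicial_cycle_group:
  "carrier (simplicial_cycle_group p K) = simplicial_cycles p K"
  unfolding simplicial_cycle_group_def
  by (rule subgroup.carrier_subgroup_generated_subgroup[OF subgroup_simplicial_cycles])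

lemma mult_simplicial_cycle_group: "a \<otimes>\<^bsub>simplicial_cycle_group p K\<^esub> b = a + b"
  by (simp add: simplicial_cycle_group_def simplicial_chain_group_def)

lemma comm_group_simplicial_cycle_group: "comm_group (simplicial_cycle_group p K)"
  unfolding simplicial_cycle_group_def simplicial_chain_group_def
  by (simp add: group.abelian_subgroup_generated abelian_free_Abelian_group)

lemma simplicial_boundaries_subset_cycles:
  "finite_complex K \<Longrightarrow> simplicial_boundaries p K \<subseteq> simplicial_cycles p K"
  by (auto simp: simplicial_boundaries_def simplicial_cycles_def chain_bd_closed chain_bd_chain_bd)

lemma simplicial_boundaries_0: "0 \<in> simplicial_boundaries p K"
proof -
  have "0 \<in> carrier (simplicial_chain_group (Suc p) K)"
    by (simp add: simplicial_chain_group_def)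
  then show ?thesis
    unfolding simplicial_boundaries_def by (metis chain_bd_0 imageI)
qed

lemma simplicial_boundaries_add:
  assumes "a \<in> simplicial_boundaries p K" "b \<in> simplicial_boundaries p K"
  shows "a + b \<in> simplicial_boundaries p K"
proof -
  from assms obtain c d where
    "c \<in> carrier (simplicial_chain_group (Suc p) K)" "a = chain_bd (Suc p) c"
    "d \<in> carrier (simplicial_chain_group (Suc p) K)" "b = chain_bd (Suc p) d"
    by (auto simp: simplicial_boundaries_def)
  then have "c + d \<in> carrier (simplicial_chain_group (Suc p) K)" "a + b = chain_bd (Suc p) (c + d)"
    using keys_add[of c d] by (auto simp: simplicial_chain_group_def chain_bd_add)
  then show ?thesis by (auto simp: simplicial_boundaries_def)
qed

lemma simplicial_boundaries_minus:
  assumes "a \<in> simplicial_boundaries p K"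
  shows "- a \<in> simplicial_boundaries p K"
proof -
  from assms obtain c where
    "c \<in> carrier (simplicial_chain_group (Suc p) K)" "a = chain_bd (Suc p) c"
    by (auto simp: simplicial_boundaries_def)
  then have "- c \<in> carrier (simplicial_chain_group (Suc p) K)" "- a = chain_bd (Suc p) (- c)"
    by (auto simp: simplicial_chain_group_def chain_bd_minus)
  then show ?thesis by (auto simp: simplicial_boundaries_def)
qed

lemma normal_simplicial_boundaries:
  assumes "finite_complex K"
  shows "simplicial_boundaries p K \<lhd> simplicial_cycle_group p K"
proof -
  let ?Z = "simplicial_cycle_group p K"
  interpret Z: comm_group ?Z by (rule comm_group_simplicial_cycle_group)
  have sub: "simplicial_boundaries p K \<subseteq> carrier ?Z"
    by (simp add: carrier_simplicial_cycle_group simplicial_boundaries_subset_cycles[OF assms])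
  have one: "\<one>\<^bsub>?Z\<^esub> = 0"
    by (simp add: simplicial_cycle_group_def simplicial_chain_group_def)
  have "subgroup (simplicial_boundaries p K) ?Z"
  proof (rule Z.subgroupI[OF sub])
    fix a assume a: "a \<in> simplicial_boundaries p K"
    have "inv\<^bsub>?Z\<^esub> a = - a"
      using a sub simplicial_boundaries_minus[OF a]
      by (intro Z.inv_equality) (auto simp: mult_simplicial_cycle_group one)
    then show "inv\<^bsub>?Z\<^esub> a \<in> simplicial_boundaries p K"
      using simplicial_boundaries_minus[OF a] by simp
  qed (use simplicial_boundaries_0 in
        \<open>auto simp: mult_simplicial_cycle_group simplicial_boundaries_add\<close>)
  then show ?thesis by (simp add: Z.normal_iff_subgroup)
qed

lemma group_simplicial_homology: "finite_complex K \<Longrightarrow> group (simplicial_homology p K)"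
  unfolding simplicial_homology_def
  by (intro normal.factorgroup_is_group normal_simplicial_boundaries)

lemma simplicial_boundaries_mono:
  "K \<subseteq> L \<Longrightarrow> simplicial_boundaries p K \<subseteq> simplicial_boundaries p L"
  unfolding simplicial_boundaries_def simplicial_chain_group_def simplices_def
  by (intro image_mono) (simp add: subset_iff)

lemma homology_incl_coset:
  assumes "K \<subseteq> L"
  shows "homology_incl p K L (simplicial_boundaries p K #>\<^bsub>simplicial_cycle_group p K\<^esub> c)
       = simplicial_boundaries p L #>\<^bsub>simplicial_cycle_group p L\<^esub> c"
proof -
  let ?B = "simplicial_boundaries p"
  have cos: "?B M #>\<^bsub>simplicial_cycle_group p M\<^esub> d = {b + d |b. b \<in> ?B M}" for M and d
    by (auto simp: r_coset_def mult_simplicial_cycle_group)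
  have 1: "\<exists>b''. b' + (b + c) = b'' + c \<and> b'' \<in> ?B L" if "b \<in> ?B K" "b' \<in> ?B L" for b b'
    using that simplicial_boundaries_mono[OF assms]
    by (intro exI[of _ "b' + b"]) (auto simp: add.assoc intro: simplicial_boundaries_add)
  have 2: "c \<in> {b + c |b. b \<in> ?B K}"
    using simplicial_boundaries_0[of p K] by force
  show ?thesis
  proof
    show "homology_incl p K L (?B K #>\<^bsub>simplicial_cycle_group p K\<^esub> c)
        \<subseteq> ?B L #>\<^bsub>simplicial_cycle_group p L\<^esub> c"
      unfolding homology_incl_def cos using 1 by auto
    show "?B L #>\<^bsub>simplicial_cycle_group p L\<^esub> c
        \<subseteq> homology_incl p K L (?B K #>\<^bsub>simplicial_cycle_group p K\<^esub> c)"
      unfolding homology_incl_def cos using 2 by (rule UN_upper)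
  qed
qed

end

theory Submission
  imports Defs
begin

text \<open>The filtration is a point, contained in a triangulated dunce hat, contained in the dunce hat
  with one tetrahedron attached along three of its facets.

  The dunce hat has no free edge: every edge lies in at least two triangles.  A discrete Morse
  function on such a complex has a critical triangle, because a triangle \<open>\<tau>\<close> of maximal value
  could only be matched with an edge of at least the same value, and that edge would then also be
  an exception for a second triangle (\<open>critical_top_simplex_exists\<close>).  A vertex of minimal value is
  critical as well (\<open>critical_vertex_exists\<close>), so the Morse number of the dunce hat is at least
  \<open>2\<close>, while that of a point is \<open>1\<close>.

  Although the dunce hat is not collapsible, it is contractible, and this is certified by collapses
  alone: attaching the tetrahedron is an elementary expansion, so the thickened complex collapses to
  the dunce hat, but it also collapses to a point when the tetrahedron is removed through another of
  its facets.  An elementary expansion induces isomorphisms in homology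
  (\<open>homology_equivalence_expansion\<close>), hence both the point and the dunce hat have the homology of the
  thickened complex, and by the two-out-of-three property (\<open>homology_equivalence_cancel_right\<close>) the
  inclusion of the point into the dunce hat is an isomorphism too.\<close>

section \<open>Inclusions that induce isomorphisms in homology\<close>

text \<open>Bijectivity of the maps induced by the inclusion, expressed with representatives: the first
  condition is surjectivity in degree \<open>p\<close>, the second one injectivity.  Composition and
  cancellation of inclusions need no cosets in this form.\<close>

definition homology_equivalence :: "'a::linorder set set \<Rightarrow> 'a set set \<Rightarrow> bool" where
  "homology_equivalence L K \<longleftrightarrow> L \<subseteq> K \<and>
     (\<forall>p. (\<forall>z\<in>simplicial_cycles p K. \<exists>z'\<in>simplicial_cycles p L. z - z' \<in> simplicial_boundaries p K) \<and>
          simplicial_cycles p L \<inter> simplicial_boundaries p K \<subseteq> simplicial_boundaries p L)"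

lemma simplicial_boundaries_diff:
  "a \<in> simplicial_boundaries p K \<Longrightarrow> b \<in> simplicial_boundaries p K \<Longrightarrow> a - b \<in> simplicial_boundaries p K"
  using simplicial_boundaries_add[of a p K "- b"] simplicial_boundaries_minus[of b p K] by simp

lemma simplicial_cycles_mono: "L \<subseteq> K \<Longrightarrow> simplicial_cycles p L \<subseteq> simplicial_cycles p K"
  by (auto simp: simplicial_cycles_def simplicial_chain_group_def simplices_def)

lemma simplicial_cycles_diff:
  "a \<in> simplicial_cycles p K \<Longrightarrow> b \<in> simplicial_cycles p K \<Longrightarrow> a - b \<in> simplicial_cycles p K"
  using keys_diff[of a b]
  by (auto simp: simplicial_cycles_def simplicial_chain_group_def chain_bd_diff)

lemma homology_equivalence_refl: "homology_equivalence K K"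
proof -
  have "\<exists>z'\<in>simplicial_cycles p K. z - z' \<in> simplicial_boundaries p K"
    if "z \<in> simplicial_cycles p K" for p z
    using that simplicial_boundaries_0[of p K] by (intro bexI[of _ z]) auto
  then show ?thesis by (auto simp: homology_equivalence_def)
qed

lemma homology_equivalence_trans:
  assumes "homology_equivalence J L" "homology_equivalence L K"
  shows "homology_equivalence J K"
  unfolding homology_equivalence_def
proof (intro conjI allI ballI subsetI)
  show "x \<in> K" if "x \<in> J" for x
    using assms that by (auto simp: homology_equivalence_def)
next
  fix p z assume "z \<in> simplicial_cycles p K"
  then obtain y where y: "y \<in> simplicial_cycles p L" "z - y \<in> simplicial_boundaries p K"
    using assms(2) by (meson homology_equivalence_def)
  then obtain x where x: "x \<in> simplicial_cycles p J" "y - x \<in> simplicial_boundaries p L"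
    using assms(1) by (meson homology_equivalence_def)
  have "L \<subseteq> K" using assms(2) by (simp add: homology_equivalence_def)
  then have "y - x \<in> simplicial_boundaries p K"
    using x(2) simplicial_boundaries_mono by blast
  then have "(z - y) + (y - x) \<in> simplicial_boundaries p K"
    using y(2) by (rule simplicial_boundaries_add[rotated])
  then show "\<exists>x\<in>simplicial_cycles p J. z - x \<in> simplicial_boundaries p K"
    using x(1) by auto
next
  fix p z assume z: "z \<in> simplicial_cycles p J \<inter> simplicial_boundaries p K"
  have "J \<subseteq> L" using assms(1) by (simp add: homology_equivalence_def)
  then have "z \<in> simplicial_cycles p L" using z simplicial_cycles_mono by blast
  then have "z \<in> simplicial_boundaries p L"
    using z assms(2) by (auto simp: homology_equivalence_def)
  then show "z \<in> simplicial_boundaries p J"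
    using z assms(1) by (auto simp: homology_equivalence_def)
qed

text \<open>The cancellation that transfers the homology of a collapsible complex to a subcomplex that
  need not be collapsible.\<close>

lemma homology_equivalence_cancel_right:
  assumes "homology_equivalence J K" "homology_equivalence L K" "J \<subseteq> L"
  shows "homology_equivalence J L"
  unfolding homology_equivalence_def
proof (intro conjI allI ballI subsetI)
  show "x \<in> L" if "x \<in> J" for x using assms(3) that by blast
next
  have LK: "L \<subseteq> K" using assms(2) by (simp add: homology_equivalence_def)
  fix p z assume z: "z \<in> simplicial_cycles p L"
  then have "z \<in> simplicial_cycles p K" using LK simplicial_cycles_mono by blast
  then obtain x where x: "x \<in> simplicial_cycles p J" "z - x \<in> simplicial_boundaries p K"
    using assms(1) by (meson homology_equivalence_def)
  have "z - x \<in> simplicial_cycles p L"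
    using z x(1) assms(3) simplicial_cycles_mono by (blast intro: simplicial_cycles_diff)
  then have "z - x \<in> simplicial_boundaries p L"
    using x(2) assms(2) by (auto simp: homology_equivalence_def)
  then show "\<exists>x\<in>simplicial_cycles p J. z - x \<in> simplicial_boundaries p L" using x(1) by blast
next
  have LK: "L \<subseteq> K" using assms(2) by (simp add: homology_equivalence_def)
  fix p z assume "z \<in> simplicial_cycles p J \<inter> simplicial_boundaries p L"
  then have "z \<in> simplicial_cycles p J \<inter> simplicial_boundaries p K"
    using simplicial_boundaries_mono[OF LK] by blast
  then show "z \<in> simplicial_boundaries p J"
    using assms(1) unfolding homology_equivalence_def by blast
qed

lemma boundary_coset_eq_iff:
  "simplicial_boundaries p K #>\<^bsub>simplicial_cycle_group p K\<^esub> c =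
   simplicial_boundaries p K #>\<^bsub>simplicial_cycle_group p K\<^esub> d
   \<longleftrightarrow> c - d \<in> simplicial_boundaries p K"
proof -
  let ?B = "simplicial_boundaries p K"
  have cos: "?B #>\<^bsub>simplicial_cycle_group p K\<^esub> e = {b. b - e \<in> ?B}" for e
    by (force simp: r_coset_def mult_simplicial_cycle_group)
  show ?thesis
  proof
    assume "?B #>\<^bsub>simplicial_cycle_group p K\<^esub> c = ?B #>\<^bsub>simplicial_cycle_group p K\<^esub> d"
    then have "c \<in> {b. b - d \<in> ?B}" using simplicial_boundaries_0[of p K] unfolding cos by auto
    then show "c - d \<in> ?B" by simp
  next
    assume cd: "c - d \<in> ?B"
    have "b - c \<in> ?B \<longleftrightarrow> b - d \<in> ?B" for b
      using simplicial_boundaries_add[OF _ cd, of "b - c"] simplicial_boundaries_diff[OF _ cd, of "b - d"]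
      by auto
    then show "?B #>\<^bsub>simplicial_cycle_group p K\<^esub> c = ?B #>\<^bsub>simplicial_cycle_group p K\<^esub> d"
      unfolding cos by auto
  qed
qed

lemma carrier_simplicial_homology:
  "carrier (simplicial_homology p K) =
     (\<lambda>c. simplicial_boundaries p K #>\<^bsub>simplicial_cycle_group p K\<^esub> c) ` simplicial_cycles p K"
  by (auto simp: simplicial_homology_def FactGroup_def RCOSETS_def carrier_simplicial_cycle_group)

lemma mult_simplicial_homology:
  assumes "finite_complex K" "c \<in> simplicial_cycles p K" "d \<in> simplicial_cycles p K"
  shows "(simplicial_boundaries p K #>\<^bsub>simplicial_cycle_group p K\<^esub> c)
           \<otimes>\<^bsub>simplicial_homology p K\<^esub> (simplicial_boundaries p K #>\<^bsub>simplicial_cycle_group p K\<^esub> d)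
       = simplicial_boundaries p K #>\<^bsub>simplicial_cycle_group p K\<^esub> (c + d)"
  using normal.rcos_sum[OF normal_simplicial_boundaries[OF assms(1)], of c p d] assms(2,3)
  by (simp add: simplicial_homology_def carrier_simplicial_cycle_group mult_simplicial_cycle_group)

lemma homology_incl_iso:
  assumes "finite_complex L" "finite_complex K" "homology_equivalence L K"
  shows "homology_incl p L K \<in> iso (simplicial_homology p L) (simplicial_homology p K)"
proof -
  have LK: "L \<subseteq> K" using assms(3) by (simp add: homology_equivalence_def)
  let ?c = "\<lambda>M c. simplicial_boundaries p M #>\<^bsub>simplicial_cycle_group p M\<^esub> c"
  have incl: "homology_incl p L K (?c L c) = ?c K c" for c
    by (rule homology_incl_coset[OF LK])
  have ZLK: "z \<in> simplicial_cycles p K" if "z \<in> simplicial_cycles p L" for z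
    using that simplicial_cycles_mono[OF LK] by blast
  have hom: "homology_incl p L K \<in> hom (simplicial_homology p L) (simplicial_homology p K)"
    by (rule homI)
      (auto simp: carrier_simplicial_homology incl mult_simplicial_homology assms(1,2) ZLK)
  have inj: "inj_on (homology_incl p L K) (carrier (simplicial_homology p L))"
  proof (rule inj_onI)
    fix X Y assume X: "X \<in> carrier (simplicial_homology p L)" and Y: "Y \<in> carrier (simplicial_homology p L)"
      and eq: "homology_incl p L K X = homology_incl p L K Y"
    obtain c where c: "X = ?c L c" "c \<in> simplicial_cycles p L"
      using X by (auto simp: carrier_simplicial_homology)
    obtain d where d: "Y = ?c L d" "d \<in> simplicial_cycles p L"
      using Y by (auto simp: carrier_simplicial_homology)
    have "c - d \<in> simplicial_boundaries p K"
      using eq by (simp add: c(1) d(1) incl boundary_coset_eq_iff)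
    then have "c - d \<in> simplicial_boundaries p L"
      using assms(3) simplicial_cycles_diff[OF c(2) d(2)] by (auto simp: homology_equivalence_def)
    then show "X = Y" by (simp add: c(1) d(1) boundary_coset_eq_iff)
  qed
  have surj: "homology_incl p L K ` carrier (simplicial_homology p L) = carrier (simplicial_homology p K)"
  proof
    show "homology_incl p L K ` carrier (simplicial_homology p L) \<subseteq> carrier (simplicial_homology p K)"
      using hom by (auto simp: hom_def)
    show "carrier (simplicial_homology p K) \<subseteq> homology_incl p L K ` carrier (simplicial_homology p L)"
    proof
      fix X assume "X \<in> carrier (simplicial_homology p K)"
      then obtain z where z: "X = ?c K z" "z \<in> simplicial_cycles p K"
        by (auto simp: carrier_simplicial_homology)
      then obtain y where y: "y \<in> simplicial_cycles p L" "z - y \<in> simplicial_boundaries p K"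
        using assms(3) by (meson homology_equivalence_def)
      have "X = homology_incl p L K (?c L y)"
        using y(2) by (simp add: z(1) incl boundary_coset_eq_iff)
      then show "X \<in> homology_incl p L K ` carrier (simplicial_homology p L)"
        using y(1) by (auto simp: carrier_simplicial_homology)
    qed
  qed
  show ?thesis using hom inj surj by (simp add: iso_def bij_betw_def)
qed

text \<open>The isomorphisms are the inverses of the maps induced by the inclusions of \<open>L\<close>.  They commute with
  the structure maps because the inclusion of \<open>L\<close> into a later complex factors through the
  earlier ones.\<close>

lemma homology_persistence_iso_constant:
  assumes fin: "\<And>t. t \<le> n \<Longrightarrow> finite_complex (K t)" and "finite_complex L"
    and eqv: "\<And>t. t \<le> n \<Longrightarrow> homology_equivalence L (K t)"
    and mono: "\<And>t. t < n \<Longrightarrow> K t \<subseteq> K (Suc t)"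
  shows "homology_persistence_iso n K (\<lambda>t. L)"
  unfolding homology_persistence_iso_def persistence_iso_def
proof (intro allI exI conjI impI ballI)
  fix p t
  let ?i = "\<lambda>t. homology_incl p L (K t)"
  let ?\<eta> = "\<lambda>t. inv_into (carrier (simplicial_homology p L)) (?i t)"
  have iso: "?i t \<in> iso (simplicial_homology p L) (simplicial_homology p (K t))" if "t \<le> n" for t
    using homology_incl_iso[OF assms(2) fin eqv] that by blast
  show "?\<eta> t \<in> iso (simplicial_homology p (K t)) (simplicial_homology p L)" if "t \<le> n"
    using group.iso_set_sym[OF group_simplicial_homology[OF assms(2)] iso[OF that]] .
  fix X assume t: "t < n" and X: "X \<in> carrier (simplicial_homology p (K t))"
  have inv: "?\<eta> s (?i s Y) = Y" if "Y \<in> carrier (simplicial_homology p L)" "s \<le> n" for Y s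
    using iso[OF that(2)] that(1) by (simp add: iso_def bij_betw_def inv_into_f_f)
  obtain Y where Y: "Y \<in> carrier (simplicial_homology p L)" "X = ?i t Y"
    using X iso[of t] t by (auto simp: iso_def bij_betw_def)
  obtain c where c: "Y = simplicial_boundaries p L #>\<^bsub>simplicial_cycle_group p L\<^esub> c"
    using Y(1) by (auto simp: carrier_simplicial_homology)
  have LK: "L \<subseteq> K t" "L \<subseteq> K (Suc t)" using eqv t by (auto simp: homology_equivalence_def)
  have "homology_incl p (K t) (K (Suc t)) X = ?i (Suc t) Y"
    by (simp only: Y(2) c homology_incl_coset[OF LK(1)] homology_incl_coset[OF LK(2)]
        homology_incl_coset[OF mono[OF t]])
  moreover have "homology_incl p L L Y = Y"
    by (simp only: c homology_incl_coset[OF subset_refl])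
  moreover have "?\<eta> t X = Y" "?\<eta> (Suc t) (?i (Suc t) Y) = Y"
    using inv[OF Y(1)] t by (simp_all add: Y(2))
  ultimately show "?\<eta> (Suc t) (homology_incl p (K t) (K (Suc t)) X) = homology_incl p L L (?\<eta> t X)"
    by simp
qed


section \<open>Elementary expansions\<close>

text \<open>The inverse of an elementary collapse: \<open>\<tau>\<close> is attached to \<open>L\<close> along all its facets except
  \<open>\<tau> - {v}\<close>, which is new.  Neither \<open>\<tau>\<close> itself nor any other coface of \<open>\<tau> - {v}\<close> can belong to a
  complex that does not contain \<open>\<tau> - {v}\<close>, so this facet is a free face after the expansion.\<close>

definition expandable :: "'a \<Rightarrow> 'a set \<Rightarrow> 'a set set \<Rightarrow> bool" where
  "expandable v \<tau> L \<longleftrightarrow>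
     v \<in> \<tau> \<and> \<tau> - {v} \<noteq> {} \<and> \<tau> - {v} \<notin> L \<and> (\<forall>u\<in>\<tau>. u \<noteq> v \<longrightarrow> \<tau> - {u} \<in> L)"

definition expansion :: "'a \<Rightarrow> 'a set \<Rightarrow> 'a set set \<Rightarrow> 'a set set" where
  "expansion v \<tau> L = insert (\<tau> - {v}) (insert \<tau> L)"

lemma finite_expandable:
  assumes "finite_complex L" "expandable v \<tau> L"
  shows "finite \<tau>"
proof -
  obtain u where "u \<in> \<tau>" "u \<noteq> v" using assms(2) by (auto simp: expandable_def)
  then have "\<tau> - {u} \<in> L" using assms(2) by (auto simp: expandable_def)
  then show ?thesis using assms(1) by (auto simp: finite_complex_def)
qed

lemma finite_complex_face:
  "finite_complex K \<Longrightarrow> \<sigma> \<in> K \<Longrightarrow> \<rho> \<subseteq> \<sigma> \<Longrightarrow> \<rho> \<noteq> {} \<Longrightarrow> \<rho> \<in> K"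
  unfolding finite_complex_def by blast

text \<open>A face of \<open>\<tau>\<close> that misses some vertex other than \<open>v\<close> lies in an old facet; the only faces that
  miss no such vertex are the two new simplices.\<close>

lemma finite_complex_expansion:
  assumes L: "finite_complex L" and e: "expandable v \<tau> L"
  shows "finite_complex (expansion v \<tau> L)"
proof -
  have fin: "finite \<tau>" by (rule finite_expandable[OF L e])
  have face: "\<rho> \<in> expansion v \<tau> L" if "\<rho> \<subseteq> \<tau>" "\<rho> \<noteq> {}" for \<rho>
  proof (cases "\<exists>u\<in>\<tau>. u \<noteq> v \<and> u \<notin> \<rho>")
    case True
    then obtain u where u: "u \<in> \<tau>" "u \<noteq> v" "u \<notin> \<rho>" by blast
    then have "\<tau> - {u} \<in> L" using e by (auto simp: expandable_def)
    then have "\<rho> \<in> L" by (rule finite_complex_face[OF L]) (use that u in auto)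
    then show ?thesis by (simp add: expansion_def)
  next
    case False
    then have "\<tau> - {v} \<subseteq> \<rho>" by blast
    then have "\<rho> = \<tau> \<or> \<rho> = \<tau> - {v}" using that by blast
    then show ?thesis by (auto simp: expansion_def)
  qed
  have "\<rho> \<in> expansion v \<tau> L" if s: "\<sigma> \<in> expansion v \<tau> L" and r: "\<rho> \<subseteq> \<sigma>" "\<rho> \<noteq> {}" for \<sigma> \<rho>
  proof (cases "\<sigma> \<in> L")
    case True
    then show ?thesis using finite_complex_face[OF L _ r] by (simp add: expansion_def)
  next
    case False
    then have "\<sigma> \<subseteq> \<tau>" using s by (auto simp: expansion_def)
    then show ?thesis using face r by blast
  qed
  moreover have "finite (expansion v \<tau> L)" using L by (simp add: expansion_def finite_complex_def)
  moreover have "finite \<sigma> \<and> \<sigma> \<noteq> {}" if "\<sigma> \<in> expansion v \<tau> L" for \<sigma>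
    using that L fin e by (auto simp: expansion_def finite_complex_def expandable_def)
  ultimately show ?thesis unfolding finite_complex_def by blast
qed

lemma chain_bd_cmul: "chain_bd p (frag_cmul a c) = frag_cmul a (chain_bd p c)"
  by (simp add: chain_bd_def frag_extend_cmul)

lemma lookup_simplex_boundary_facet:
  assumes "finite \<tau>" "v \<in> \<tau>"
  shows "Poly_Mapping.lookup (simplex_boundary \<tau>) (\<tau> - {v}) = (-1) ^ card {w \<in> \<tau>. w < v}"
proof -
  have "Poly_Mapping.lookup (simplex_boundary \<tau>) (\<tau> - {v})
      = (\<Sum>u\<in>\<tau>. if u = v then (-1) ^ card {w \<in> \<tau>. w < v} else 0)"
    unfolding simplex_boundary_def lookup_sum
    by (intro sum.cong refl) (use assms in \<open>auto simp: lookup_frag_of\<close>)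
  then show ?thesis using assms by simp
qed

text \<open>This is the push across \<open>\<tau>\<close>, and it covers both halves of homology equivalence: applied to cycles
  it gives surjectivity, applied to a chain bounding a cycle of \<open>L\<close> it gives injectivity.  Let \<open>q\<close> be
  the dimension of the new facet \<open>\<sigma> = \<tau> - {v}\<close>.  Since \<open>\<sigma>\<close> occurs in the boundary of \<open>\<tau>\<close> with
  coefficient \<open>\<epsilon> = \<plusminus>1\<close>, a suitable multiple of that boundary cancels \<open>\<sigma>\<close> from a \<open>q\<close>-chain.  In a
  \<open>(q+1)\<close>-chain, \<open>\<tau>\<close> is the only simplex whose boundary involves \<open>\<sigma>\<close>; if the boundary of the chain avoids
  \<open>\<sigma>\<close>, then \<open>\<tau>\<close> does not occur in it.\<close>

lemma expansion_replace_chain: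
  fixes L :: "'a::linorder set set"
  assumes L: "finite_complex L" and e: "expandable v \<tau> L"
    and c: "Poly_Mapping.keys c \<subseteq> simplices p (expansion v \<tau> L)"
    and bd: "\<tau> - {v} \<notin> Poly_Mapping.keys (chain_bd p c)"
  shows "\<exists>c'. Poly_Mapping.keys c' \<subseteq> simplices p L \<and> chain_bd p c' = chain_bd p c \<and>
              c - c' \<in> simplicial_boundaries p (expansion v \<tau> L)"
proof -
  let ?K = "expansion v \<tau> L" and ?\<sigma> = "\<tau> - {v}"
  have K: "finite_complex ?K" by (rule finite_complex_expansion[OF L e])
  have fin: "finite \<tau>" by (rule finite_expandable[OF L e])
  have v: "v \<in> \<tau>" "?\<sigma> \<noteq> {}" "?\<sigma> \<notin> L" using e by (auto simp: expandable_def)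
  define q where "q = sdim ?\<sigma>"
  have "card ?\<sigma> \<noteq> 0" using fin v(2) by (simp only: card_eq_0_iff) simp
  moreover have "card \<tau> = Suc (card ?\<sigma>)" using fin v(1) by (simp only: card_Suc_Diff1)
  ultimately have dim: "sdim \<tau> = Suc q" unfolding q_def sdim_def by simp
  have simp_K: "simplices r ?K \<subseteq> simplices r L \<union> {\<rho>. \<rho> = ?\<sigma> \<and> r = q} \<union> {\<rho>. \<rho> = \<tau> \<and> r = Suc q}" for r
    using dim by (auto simp: simplices_def expansion_def q_def)
  define \<epsilon> :: int where "\<epsilon> = (-1) ^ card {w \<in> \<tau>. w < v}"
  have \<epsilon>: "\<epsilon> * \<epsilon> = 1" by (simp add: \<epsilon>_def flip: power_add)
  have bd_\<tau>: "chain_bd (Suc q) (frag_of \<tau>) = simplex_boundary \<tau>"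
    by (simp add: chain_bd_def)
  have coeff: "Poly_Mapping.lookup (simplex_boundary \<tau>) ?\<sigma> = \<epsilon>"
    by (simp add: \<epsilon>_def lookup_simplex_boundary_facet[OF fin v(1)])
  have trivial: ?thesis if "Poly_Mapping.keys c \<subseteq> simplices p L"
    using that simplicial_boundaries_0 by (intro exI[of _ c]) auto
  consider "p = q" | "p = Suc q" | "p \<noteq> q" "p \<noteq> Suc q" by blast
  then show ?thesis
  proof cases
    case 1
    (* The coefficient of \<sigma> in the boundary of b is that of \<sigma> in c times \<epsilon> squared, which is 1. *)
    define b where "b = frag_cmul (Poly_Mapping.lookup c ?\<sigma> * \<epsilon>) (frag_of \<tau>)"
    have b: "b \<in> carrier (simplicial_chain_group (Suc p) ?K)"
      using dim 1 order_trans[OF keys_cmul]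
      by (auto simp: b_def simplicial_chain_group_def simplices_def expansion_def)
    have "chain_bd (Suc p) b \<in> carrier (simplicial_chain_group p ?K)"
      by (rule chain_bd_closed[OF K b])
    then have "Poly_Mapping.keys (c - chain_bd (Suc p) b) \<subseteq> simplices p ?K"
      using c keys_diff[of c "chain_bd (Suc p) b"] by (auto simp: simplicial_chain_group_def)
    moreover have "Poly_Mapping.lookup (c - chain_bd (Suc p) b) ?\<sigma> = 0"
      using \<epsilon> 1 by (simp add: b_def chain_bd_cmul bd_\<tau> lookup_minus coeff)
    then have "?\<sigma> \<notin> Poly_Mapping.keys (c - chain_bd (Suc p) b)"
      by (simp add: in_keys_iff)
    ultimately have "Poly_Mapping.keys (c - chain_bd (Suc p) b) \<subseteq> simplices p L"
      using simp_K[of p] 1 by auto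
    moreover have "chain_bd p (c - chain_bd (Suc p) b) = chain_bd p c"
      by (simp add: chain_bd_diff chain_bd_chain_bd[OF K b])
    moreover have "c - (c - chain_bd (Suc p) b) \<in> simplicial_boundaries p ?K"
      using b by (auto simp: simplicial_boundaries_def)
    ultimately show ?thesis by blast
  next
    case 2
    define a where "a = Poly_Mapping.lookup c \<tau>"
    define c0 where "c0 = c - frag_cmul a (frag_of \<tau>)"
    have keys_a: "Poly_Mapping.keys (frag_cmul a (frag_of \<tau>)) \<subseteq> simplices p ?K"
      using dim 2 order_trans[OF keys_cmul] by (auto simp: simplices_def expansion_def)
    have "Poly_Mapping.keys c0 \<subseteq> simplices p ?K"
      using c keys_a keys_diff[of c "frag_cmul a (frag_of \<tau>)"] unfolding c0_def by blast
    moreover have "\<tau> \<notin> Poly_Mapping.keys c0"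
      by (simp add: in_keys_iff c0_def lookup_minus a_def)
    ultimately have c0: "c0 \<in> carrier (simplicial_chain_group (Suc q) L)"
      using simp_K[of p] 2 by (auto simp: simplicial_chain_group_def)
    have "?\<sigma> \<notin> Poly_Mapping.keys (chain_bd (Suc q) c0)"
      using chain_bd_closed[OF L c0] v(3) by (auto simp: simplicial_chain_group_def simplices_def)
    moreover have "chain_bd p c = chain_bd p c0 + frag_cmul a (simplex_boundary \<tau>)"
      using 2 by (simp add: c0_def chain_bd_diff chain_bd_cmul bd_\<tau>)
    ultimately have "a * \<epsilon> = 0"
      using bd 2 by (simp add: in_keys_iff lookup_add coeff)
    then have "a = 0" using \<epsilon> by auto
    then have "c = c0" by (simp add: c0_def)
    then show ?thesis using c0 2 trivial by (simp add: simplicial_chain_group_def)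
  next
    case 3
    then show ?thesis using c simp_K[of p] trivial by auto
  qed
qed

lemma homology_equivalence_expansion:
  fixes L :: "'a::linorder set set"
  assumes L: "finite_complex L" and e: "expandable v \<tau> L"
  shows "homology_equivalence L (expansion v \<tau> L)"
  unfolding homology_equivalence_def
proof (intro conjI allI ballI subsetI)
  show "x \<in> expansion v \<tau> L" if "x \<in> L" for x
    using that by (simp add: expansion_def)
next
  fix p z assume "z \<in> simplicial_cycles p (expansion v \<tau> L)"
  then show "\<exists>z'\<in>simplicial_cycles p L. z - z' \<in> simplicial_boundaries p (expansion v \<tau> L)"
    using expansion_replace_chain[OF L e, of z p]
    by (auto simp: simplicial_cycles_def simplicial_chain_group_def)
next
  fix p z assume z: "z \<in> simplicial_cycles p L \<inter> simplicial_boundaries p (expansion v \<tau> L)"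
  then obtain c where c: "Poly_Mapping.keys c \<subseteq> simplices (Suc p) (expansion v \<tau> L)"
      "z = chain_bd (Suc p) c"
    by (auto simp: simplicial_boundaries_def simplicial_chain_group_def)
  have "\<tau> - {v} \<notin> Poly_Mapping.keys z"
    using z e by (auto simp: simplicial_cycles_def simplicial_chain_group_def simplices_def expandable_def)
  then obtain c' where "Poly_Mapping.keys c' \<subseteq> simplices (Suc p) L" "chain_bd (Suc p) c' = z"
    using expansion_replace_chain[OF L e c(1)] c(2) by auto
  then show "z \<in> simplicial_boundaries p L"
    by (auto simp: simplicial_boundaries_def simplicial_chain_group_def)
qed

text \<open>A pair \<open>(v, \<tau>)\<close> stands for the expansion that adds \<open>\<tau> - {v}\<close> and \<open>\<tau>\<close>.  Both functions are
  executable on finite sets, so that a given sequence of expansions can be checked by rewriting.\<close>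

primrec expandable_list :: "('a \<times> 'a set) list \<Rightarrow> 'a set set \<Rightarrow> bool" where
  "expandable_list [] L \<longleftrightarrow> True"
| "expandable_list (s # ss) L \<longleftrightarrow>
     expandable (fst s) (snd s) L \<and> expandable_list ss (expansion (fst s) (snd s) L)"

primrec expansion_list :: "('a \<times> 'a set) list \<Rightarrow> 'a set set \<Rightarrow> 'a set set" where
  "expansion_list [] L = L"
| "expansion_list (s # ss) L = expansion_list ss (expansion (fst s) (snd s) L)"

lemma expansion_list_homology_equivalence:
  fixes L :: "'a::linorder set set"
  assumes "finite_complex L" "expandable_list ss L"
  shows "finite_complex (expansion_list ss L) \<and> homology_equivalence L (expansion_list ss L)"
  using assms
proof (induction ss arbitrary: L)
  case Nil
  then show ?case by (simp add: homology_equivalence_refl)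
next
  case (Cons s ss)
  then have e: "expandable (fst s) (snd s) L" by simp
  show ?case
    using Cons.IH[OF finite_complex_expansion[OF Cons.prems(1) e]] Cons.prems(2)
      homology_equivalence_trans[OF homology_equivalence_expansion[OF Cons.prems(1) e]]
    by simp
qed


section \<open>Critical simplices of discrete Morse functions\<close>

text \<open>Take a vertex \<open>v\<close> of minimal value.  If an edge had a value not above that of \<open>v\<close>, then both its
  end points would be exceptions for that edge.\<close>

lemma critical_vertex_exists:
  assumes K: "finite_complex K" "K \<noteq> {}" and f: "discrete_morse K f"
  shows "\<exists>v. critical K f {v}"
proof -
  have fin: "finite (\<Union>K)" using K(1) by (auto simp: finite_complex_def)
  have ne: "\<Union>K \<noteq> {}" using K by (auto simp: finite_complex_def)
  obtain v where v: "v \<in> \<Union>K" and min: "\<And>w. w \<in> \<Union>K \<Longrightarrow> f {v} \<le> f {w}"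
    using obtains_MIN[OF fin ne, of "\<lambda>v. f {v}"] fin by (metis (no_types, lifting) Min_le finite_imageI imageI)
  have vert: "{w} \<in> K" if "w \<in> \<Union>K" for w
    using that finite_complex_face[OF K(1)] by blast
  have False if ex: "\<tau> \<in> morse_exceptions K f {v}" for \<tau>
  proof -
    have "\<not> \<tau> \<subset> {v} \<or> \<tau> \<notin> K" using K(1) by (auto simp: finite_complex_def)
    then have \<tau>: "\<tau> \<in> K" "{v} \<subset> \<tau>" "sdim \<tau> = Suc (sdim {v})" "f \<tau> \<le> f {v}"
      using ex by (auto simp: morse_exceptions_def)
    obtain w where w: "w \<in> \<tau>" "w \<noteq> v" using \<tau>(2) by blast
    have sub: "{u} \<in> morse_exceptions K f \<tau>" if "u \<in> \<tau>" for u
    proof -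
      have "u \<in> \<Union>K" using that \<tau>(1) by blast
      then have "{u} \<in> K" "f \<tau> \<le> f {u}" using vert min \<tau>(4) by (auto intro: order_trans)
      moreover have "{u} \<subset> \<tau>" using that w \<tau>(2) by blast
      ultimately show ?thesis using \<tau>(3) by (simp add: morse_exceptions_def sdim_def)
    qed
    have "v \<in> \<tau>" using \<tau>(2) by blast
    then have "{{v}, {w}} \<subseteq> morse_exceptions K f \<tau>" using sub w by blast
    then show False using f \<tau>(1) w(2) unfolding discrete_morse_def by blast
  qed
  then show ?thesis using vert[OF v] by (auto simp: critical_def)
qed

text \<open>The dual argument: take \<open>\<tau>\<close> of maximal value among the simplices of top dimension.  If a facet
  \<open>\<sigma>\<close> had a value not below that of \<open>\<tau>\<close>, then every coface of \<open>\<sigma>\<close>, of which there are at least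
  two, would be an exception for \<open>\<sigma>\<close>.\<close>

lemma critical_top_simplex_exists:
  assumes K: "finite_complex K" and f: "discrete_morse K f"
    and top: "\<And>\<sigma>. \<sigma> \<in> K \<Longrightarrow> sdim \<sigma> \<le> Suc n" "simplices (Suc n) K \<noteq> {}"
    and no_free: "\<And>\<sigma> \<tau>. \<sigma> \<in> simplices n K \<Longrightarrow> \<tau> \<in> simplices (Suc n) K \<Longrightarrow> \<sigma> \<subset> \<tau> \<Longrightarrow>
      \<exists>\<tau>'\<in>simplices (Suc n) K. \<sigma> \<subset> \<tau>' \<and> \<tau>' \<noteq> \<tau>"
  shows "\<exists>\<tau> \<in> simplices (Suc n) K. critical K f \<tau>"
proof -
  have fin: "finite (simplices (Suc n) K)"
    using K by (auto simp: finite_complex_def simplices_def)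
  obtain \<tau> where \<tau>: "\<tau> \<in> simplices (Suc n) K"
    and max: "\<And>\<tau>'. \<tau>' \<in> simplices (Suc n) K \<Longrightarrow> f \<tau>' \<le> f \<tau>"
    using obtains_MAX[OF fin top(2), of f] fin by (metis Max_ge finite_imageI imageI)
  have False if ex: "\<sigma> \<in> morse_exceptions K f \<tau>" for \<sigma>
  proof -
    have dim: "sdim \<tau> = Suc n" using \<tau> by (simp add: simplices_def)
    consider "\<sigma> \<in> K" "\<sigma> \<subset> \<tau>" "f \<tau> \<le> f \<sigma>" "sdim \<tau> = Suc (sdim \<sigma>)" | "\<sigma> \<in> K" "sdim \<sigma> = Suc (sdim \<tau>)"
      using ex unfolding morse_exceptions_def by blast
    then have "\<sigma> \<in> simplices n K \<and> \<sigma> \<subset> \<tau> \<and> f \<tau> \<le> f \<sigma>"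
      by cases (use dim top(1)[of \<sigma>] in \<open>simp_all add: simplices_def\<close>)
    then have \<sigma>: "\<sigma> \<in> simplices n K" "\<sigma> \<subset> \<tau>" "f \<tau> \<le> f \<sigma>" by auto
    obtain \<tau>' where \<tau>': "\<tau>' \<in> simplices (Suc n) K" "\<sigma> \<subset> \<tau>'" "\<tau>' \<noteq> \<tau>"
      using no_free[OF \<sigma>(1) \<tau> \<sigma>(2)] by blast
    have "\<rho> \<in> morse_exceptions K f \<sigma>" if "\<rho> \<in> simplices (Suc n) K" "\<sigma> \<subset> \<rho>" for \<rho>
      using that max[of \<rho>] \<sigma> by (auto simp: morse_exceptions_def simplices_def)
    then have "{\<tau>, \<tau>'} \<subseteq> morse_exceptions K f \<sigma>" using \<tau> \<tau>' \<sigma>(2) by blast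
    moreover have "\<sigma> \<in> K" using \<sigma>(1) by (simp add: simplices_def)
    ultimately show False using f \<tau>'(3) unfolding discrete_morse_def by blast
  qed
  then show ?thesis using \<tau> by (auto simp: critical_def simplices_def)
qed

lemma sum_critical_count:
  assumes "finite K"
  shows "(\<Sum>i\<in>sdim ` K. critical_count K f i) = card {\<sigma> \<in> K. critical K f \<sigma>}"
proof -
  have "card (\<Union>i\<in>sdim ` K. {\<sigma> \<in> simplices i K. critical K f \<sigma>})
      = (\<Sum>i\<in>sdim ` K. card {\<sigma> \<in> simplices i K. critical K f \<sigma>})"
  proof (rule card_UN_disjoint)
    show "\<forall>i\<in>sdim ` K. finite {\<sigma> \<in> simplices i K. critical K f \<sigma>}"
      using assms by (simp add: simplices_def)
    show "\<forall>i\<in>sdim ` K. \<forall>j\<in>sdim ` K. i \<noteq> j \<longrightarrow>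
        {\<sigma> \<in> simplices i K. critical K f \<sigma>} \<inter> {\<sigma> \<in> simplices j K. critical K f \<sigma>} = {}"
      unfolding simplices_def by blast
  qed (use assms in simp)
  moreover have "(\<Union>i\<in>sdim ` K. {\<sigma> \<in> simplices i K. critical K f \<sigma>}) = {\<sigma> \<in> K. critical K f \<sigma>}"
    unfolding simplices_def by blast
  ultimately show ?thesis by (simp add: critical_count_def)
qed

text \<open>The dimension is a discrete Morse function for which all simplices are critical, so the minimum that
  defines the Morse number is taken over a nonempty set.\<close>

lemma discrete_morse_sdim: "discrete_morse K (\<lambda>\<sigma>. real (sdim \<sigma>))"
proof -
  have "morse_exceptions K (\<lambda>\<sigma>. real (sdim \<sigma>)) \<sigma> = {}" for \<sigma>
    by (auto simp: morse_exceptions_def)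
  then show ?thesis by (simp add: discrete_morse_def)
qed

lemma morse_number_attained:
  assumes "finite K"
  shows "\<exists>f. discrete_morse K f \<and> morse_number K = card {\<sigma> \<in> K. critical K f \<sigma>}"
proof -
  let ?P = "\<lambda>m. \<exists>f. discrete_morse K f \<and> m = (\<Sum>i\<in>sdim ` K. critical_count K f i)"
  have "?P (morse_number K)"
    unfolding morse_number_def by (rule LeastI_ex) (use discrete_morse_sdim in blast)
  then show ?thesis using sum_critical_count[OF assms] by auto
qed

lemma morse_number_point: "morse_number {{v}} = 1"
proof -
  obtain f where f: "discrete_morse {{v}} f"
      "morse_number {{v}} = card {\<sigma> \<in> {{v}}. critical {{v}} f \<sigma>}"
    using morse_number_attained[of "{{v}}"] by auto
  have "{\<sigma> \<in> {{v}}. critical {{v}} f \<sigma>} = {{v}}"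
    by (auto simp: critical_def morse_exceptions_def)
  then show ?thesis using f(2) by simp
qed

lemma morse_number_ge_2_if_no_free_face:
  assumes K: "finite_complex K"
    and top: "\<And>\<sigma>. \<sigma> \<in> K \<Longrightarrow> sdim \<sigma> \<le> Suc n" "simplices (Suc n) K \<noteq> {}"
    and no_free: "\<And>\<sigma> \<tau>. \<sigma> \<in> simplices n K \<Longrightarrow> \<tau> \<in> simplices (Suc n) K \<Longrightarrow> \<sigma> \<subset> \<tau> \<Longrightarrow>
      \<exists>\<tau>'\<in>simplices (Suc n) K. \<sigma> \<subset> \<tau>' \<and> \<tau>' \<noteq> \<tau>"
  shows "2 \<le> morse_number K"
proof -
  have fin: "finite K" using K by (simp add: finite_complex_def)
  obtain f where f: "discrete_morse K f" "morse_number K = card {\<sigma> \<in> K. critical K f \<sigma>}"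
    using morse_number_attained[OF fin] by blast
  obtain \<tau> where \<tau>: "\<tau> \<in> simplices (Suc n) K" "critical K f \<tau>"
    using critical_top_simplex_exists[OF K f(1) top no_free] by blast
  have "K \<noteq> {}" using top(2) by (auto simp: simplices_def)
  then obtain v where v: "critical K f {v}" using critical_vertex_exists[OF K _ f(1)] by blast
  have "{v} \<noteq> \<tau>" using \<tau>(1) by (auto simp: simplices_def sdim_def)
  then have "card {{v}, \<tau>} = 2" by simp
  moreover have "{{v}, \<tau>} \<subseteq> {\<sigma> \<in> K. critical K f \<sigma>}" using v \<tau>(2) by (auto simp: critical_def)
  ultimately show ?thesis using card_mono[of "{\<sigma> \<in> K. critical K f \<sigma>}" "{{v}, \<tau>}"] fin f(2) by simp
qed


section \<open>The dunce hat\<close>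

lemma connected_complex_dominating_vertex:
  assumes "K \<noteq> {}" "\<And>v. v \<in> \<Union>K \<Longrightarrow> {b, v} \<in> K"
  shows "connected_complex K"
  unfolding connected_complex_def
proof (intro conjI ballI)
  let ?E = "{(a, c). {a, c} \<in> K}"
  fix u v assume "u \<in> \<Union>K" "v \<in> \<Union>K"
  then have "{b, u} \<in> K" "{b, v} \<in> K" using assms(2) by auto
  then have "(u, b) \<in> ?E" "(b, v) \<in> ?E" by (auto simp: insert_commute)
  then show "(u, v) \<in> ?E\<^sup>*" by (meson r_into_rtrancl rtrancl_into_rtrancl)
qed (fact assms(1))

text \<open>The dunce hat is a disc whose boundary is glued along the word \<open>a a a\<^sup>-\<^sup>1\<close>.  Here the loop \<open>a\<close> runs
  through the vertices \<open>0, 1, 2\<close> and back to \<open>0\<close>, so the boundary is a nonagon with labels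
  \<open>0, 1, 2, 0, 1, 2, 0, 2, 1\<close>, and \<open>3, \<dots>, 7\<close> are the interior vertices of the disc.  The three edges
  of \<open>a\<close> lie in three triangles each, all others in two.\<close>

definition dunce_hat_triangles :: "nat set set" where
  "dunce_hat_triangles =
    {{0,1,4}, {0,1,5}, {0,1,6}, {0,2,3}, {0,2,6}, {0,2,7}, {0,3,7}, {0,4,5}, {1,2,3},
     {1,2,4}, {1,2,5}, {1,3,6}, {2,4,7}, {2,5,6}, {3,4,5}, {3,4,7}, {3,5,6}}"

definition dunce_hat :: "nat set set" where
  "dunce_hat = (\<Union>F\<in>dunce_hat_triangles. Pow F) - {{}}"

text \<open>The facets \<open>{0,2,3}\<close>, \<open>{0,2,7}\<close> and \<open>{0,3,7}\<close> of the tetrahedron are triangles of the dunce hat, and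
  \<open>{2,3,7}\<close> is new.\<close>

definition thick_dunce_hat :: "nat set set" where
  "thick_dunce_hat = expansion 0 {0,2,3,7} dunce_hat"

text \<open>The reverse of a collapse to the vertex \<open>0\<close>.  The first seven steps grow a spanning tree, the next
  seventeen add an edge and a triangle each.  The last one adds the tetrahedron with the
  facet \<open>{0,2,7}\<close>, not with \<open>{2,3,7}\<close>: removing \<open>{0,2,7}\<close> from the dunce hat is what makes the edge
  \<open>{0,7}\<close> free, so that the collapse can go on.\<close>

definition thick_dunce_hat_expansions :: "(nat \<times> nat set) list" where
  "thick_dunce_hat_expansions =
    [(0, {0,1}), (1, {1,4}), (4, {2,4}), (4, {3,4}), (4, {4,5}), (5, {5,6}), (3, {3,7}),
     (3, {3,4,7}), (4, {2,4,7}), (7, {2,3,7}), (4, {1,2,4}), (1, {0,1,4}), (4, {0,4,5}),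
     (0, {0,1,5}), (4, {3,4,5}), (2, {1,2,3}), (5, {3,5,6}), (3, {1,3,6}), (1, {1,2,5}),
     (5, {2,5,6}), (1, {0,1,6}), (6, {0,2,6}), (2, {0,2,3}), (3, {0,3,7}),
     (3, {0,2,3,7})]"

lemma thick_dunce_hat_expandable:
  "expandable_list thick_dunce_hat_expansions {{0}}"
  by code_simp

lemma thick_dunce_hat_eq_expansion:
  "expansion_list thick_dunce_hat_expansions {{0}} = thick_dunce_hat"
  by code_simp

lemma dunce_hat_expandable: "expandable 0 {0,2,3,7} dunce_hat"
  by code_simp

lemma card_dunce_hat_triangle: "F \<in> dunce_hat_triangles \<Longrightarrow> card F = 3"
  by (auto simp: dunce_hat_triangles_def)

lemma dunce_hat_no_free_edge:
  "\<forall>F\<in>dunce_hat_triangles. \<forall>v\<in>F. \<exists>F'\<in>dunce_hat_triangles. F - {v} \<subseteq> F' \<and> F' \<noteq> F"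
  by code_simp

text \<open>Every vertex is adjacent to \<open>0\<close>, which gives edge paths of length at most two between any two
  vertices.\<close>

lemma dunce_hat_dominating_vertex:
  "\<forall>F\<in>dunce_hat_triangles. \<forall>v\<in>F. \<exists>F'\<in>dunce_hat_triangles. {0, v} \<subseteq> F'"
  by code_simp

lemma finite_complex_dunce_hat: "finite_complex dunce_hat"
proof -
  have "finite F" if "F \<in> dunce_hat_triangles" for F
    using card_dunce_hat_triangle[OF that] by (simp add: card_ge_0_finite)
  moreover have "finite dunce_hat_triangles" by (simp add: dunce_hat_triangles_def)
  ultimately show ?thesis
    unfolding finite_complex_def dunce_hat_def by (blast intro: finite_subset)
qed

text \<open>The boundary triangle \<open>{0,1,2}\<close> of the gluing loop has all its edges in the dunce hat without
  being one of its simplices; only the listed triangles are.\<close>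

lemma triangles_of_dunce_hat: "simplices (Suc 1) dunce_hat = dunce_hat_triangles"
proof
  show "dunce_hat_triangles \<subseteq> simplices (Suc 1) dunce_hat"
    using card_dunce_hat_triangle by (force simp: simplices_def sdim_def dunce_hat_def)
  show "simplices (Suc 1) dunce_hat \<subseteq> dunce_hat_triangles"
  proof
    fix \<tau> assume "\<tau> \<in> simplices (Suc 1) dunce_hat"
    then have "\<tau> \<in> dunce_hat" "card \<tau> - 1 = 2" by (simp_all add: simplices_def sdim_def)
    then obtain F where F: "F \<in> dunce_hat_triangles" "\<tau> \<subseteq> F" and "card \<tau> = 3"
      by (fastforce simp: dunce_hat_def)
    then have "\<tau> = F" using card_dunce_hat_triangle[OF F(1)]
      by (intro card_subset_eq) (simp_all add: card_ge_0_finite)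
    then show "\<tau> \<in> dunce_hat_triangles" using F(1) by simp
  qed
qed

lemma morse_number_dunce_hat: "2 \<le> morse_number dunce_hat"
proof (rule morse_number_ge_2_if_no_free_face[OF finite_complex_dunce_hat, of 1])
  fix \<sigma> assume "\<sigma> \<in> dunce_hat"
  then obtain F where F: "F \<in> dunce_hat_triangles" "\<sigma> \<subseteq> F" by (auto simp: dunce_hat_def)
  then have "card \<sigma> \<le> 3"
    using card_mono[OF _ F(2)] card_dunce_hat_triangle[OF F(1)] by (simp add: card_ge_0_finite)
  then show "sdim \<sigma> \<le> Suc 1" by (simp add: sdim_def)
next
  show "simplices (Suc 1) dunce_hat \<noteq> {}"
    unfolding triangles_of_dunce_hat by (simp add: dunce_hat_triangles_def)
next
  fix \<sigma> \<tau> assume \<sigma>: "\<sigma> \<in> simplices 1 dunce_hat" and \<tau>: "\<tau> \<in> simplices (Suc 1) dunce_hat"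
    and sub: "\<sigma> \<subset> \<tau>"
  have F: "\<tau> \<in> dunce_hat_triangles" using \<tau> triangles_of_dunce_hat by simp
  obtain v where v: "v \<in> \<tau>" "\<sigma> \<subseteq> \<tau> - {v}" using sub by blast
  obtain F' where F': "F' \<in> dunce_hat_triangles" "\<tau> - {v} \<subseteq> F'" "F' \<noteq> \<tau>"
    using dunce_hat_no_free_edge F v(1) by blast
  have "card \<sigma> - 1 = 1" using \<sigma> by (simp add: simplices_def sdim_def)
  then have "card \<sigma> = 2" by linarith
  then have "\<sigma> \<noteq> F'" using card_dunce_hat_triangle[OF F'(1)] by auto
  then have "\<sigma> \<subset> F'" using v(2) F'(2) by blast
  then show "\<exists>\<tau>'\<in>simplices (Suc 1) dunce_hat. \<sigma> \<subset> \<tau>' \<and> \<tau>' \<noteq> \<tau>"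
    unfolding triangles_of_dunce_hat using F'(1,3) by blast
qed

lemma dunce_hat_edge_to_0:
  assumes "v \<in> \<Union>dunce_hat"
  shows "{0, v} \<in> dunce_hat"
proof -
  obtain F where "F \<in> dunce_hat_triangles" "v \<in> F" using assms by (auto simp: dunce_hat_def)
  then show ?thesis using dunce_hat_dominating_vertex by (fastforce simp: dunce_hat_def)
qed

lemma thick_dunce_hat_edge_to_0:
  assumes "v \<in> \<Union>thick_dunce_hat"
  shows "{0, v} \<in> thick_dunce_hat"
proof -
  have "{0,2,7} \<in> dunce_hat" "{0,3,7} \<in> dunce_hat"
    by (simp_all add: dunce_hat_def dunce_hat_triangles_def)
  then have "v \<in> \<Union>dunce_hat"
    using assms unfolding thick_dunce_hat_def expansion_def by blast
  then show ?thesis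
    using dunce_hat_edge_to_0[of v] by (simp add: thick_dunce_hat_def expansion_def)
qed

lemma finite_complex_point: "finite_complex {{v}}"
  by (auto simp: finite_complex_def)

lemma homology_equivalence_point_thick_dunce_hat: "homology_equivalence {{0}} thick_dunce_hat"
  using expansion_list_homology_equivalence[OF finite_complex_point thick_dunce_hat_expandable]
  by (simp add: thick_dunce_hat_eq_expansion)

lemma homology_equivalence_dunce_hat_thick_dunce_hat:
  "homology_equivalence dunce_hat thick_dunce_hat"
  unfolding thick_dunce_hat_def
  by (rule homology_equivalence_expansion[OF finite_complex_dunce_hat dunce_hat_expandable])

text \<open>No sequence of expansions leads from the point to the dunce hat directly, since the last one would
  leave a free face; the detour is over the thickened complex.\<close>

lemma homology_equivalence_point_dunce_hat: "homology_equivalence {{0}} dunce_hat"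
proof (rule homology_equivalence_cancel_right)
  show "{{0}} \<subseteq> dunce_hat" by (simp add: dunce_hat_def dunce_hat_triangles_def)
qed (fact homology_equivalence_point_thick_dunce_hat homology_equivalence_dunce_hat_thick_dunce_hat)+

theorem theorem2:
  shows "\<exists>K :: nat \<Rightarrow> nat set set.
    filtration 2 K \<and>
    (\<forall>t\<le>2. connected_complex (K t)) \<and>
    (\<forall>i j p. i \<le> j \<longrightarrow> j \<le> 2 \<longrightarrow>
       homology_incl p (K i) (K j) \<in> iso (simplicial_homology p (K i)) (simplicial_homology p (K j))) \<and>
    homology_persistence_iso 2 K (\<lambda>t. {{0 :: nat}}) \<and>
    \<not> (\<exists>m. \<forall>t\<le>2. morse_number (K t) = m)"
proof -
  define K :: "nat \<Rightarrow> nat set set"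
    where "K t = (if t = 0 then {{0}} else if t = 1 then dunce_hat else thick_dunce_hat)" for t
  have fin: "finite_complex (K t)" for t
    using finite_complex_point[of "0 :: nat"] finite_complex_dunce_hat
      finite_complex_expansion[OF finite_complex_dunce_hat dunce_hat_expandable]
    by (simp add: K_def thick_dunce_hat_def)
  have eqv: "homology_equivalence (K i) (K j)" if "i \<le> j" for i j
    using that homology_equivalence_refl homology_equivalence_point_dunce_hat
      homology_equivalence_point_thick_dunce_hat homology_equivalence_dunce_hat_thick_dunce_hat
    by (auto simp: K_def)
  then have mono: "K t \<subseteq> K (Suc t)" for t
    by (meson homology_equivalence_def le_SucI order_refl)
  have conn: "connected_complex (K t)" for t
  proof (rule connected_complex_dominating_vertex)
    have "K 0 \<subseteq> K t" using eqv[of 0 t] by (simp add: homology_equivalence_def)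
    then show "K t \<noteq> {}" by (auto simp: K_def)
    show "{0, v} \<in> K t" if "v \<in> \<Union>(K t)" for v
      using that dunce_hat_edge_to_0[of v] thick_dunce_hat_edge_to_0[of v]
      by (auto simp: K_def split: if_splits)
  qed
  have "homology_persistence_iso 2 K (\<lambda>t. {{0 :: nat}})"
  proof (rule homology_persistence_iso_constant)
    show "homology_equivalence {{0}} (K t)" for t
      using eqv[of 0 t] by (simp add: K_def[of 0])
  qed (rule fin mono finite_complex_point)+
  moreover have "morse_number (K 0) \<noteq> morse_number (K 1)"
    using morse_number_dunce_hat by (simp add: K_def morse_number_point)
  then have "\<not> (\<exists>m. \<forall>t\<le>2. morse_number (K t) = m)"
    by (metis one_le_numeral zero_le)
  ultimately show ?thesis
    using fin mono conn homology_incl_iso[OF fin fin eqv]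
    by (intro exI[of _ K]) (simp add: filtration_def)
qed

end
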